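(* Let $n\ge 1$ and let $\mathcal{N}=A^+(B_n)\cup\{0\}$ be the zero-symmetric affine near-semiring over the Brandt semigroup $B_n$. The near-semiring $\mathcal{N}$ has precisely the following congruences: (1) the equality relation; (2) $\mathcal{N}\times\mathcal{N}$; (3) $(A^+(B_n)\times A^+(B_n))\cup\{(0,0)\}$. Hence, $\mathcal{N}$ and $\{0\}$ are the only ideals of the near-semiring $\mathcal{N}$.
   Context: Arguments of maps are written on the left: $xf$ is the value of $f$ at $x$. A near-semiring is a triple $(\mathcal{M},+,\cdot)$ such that $(\mathcal{M},+)$ and $(\mathcal{M},\cdot)$ are semigroups (not assumed commutative) and $a\cdot(b+c)=a\cdot b+a\cdot c$ for all $a,b,c$. It is zero-symmetric if there is $0\in\mathcal{M}$ with $a+0=0+a=a$ and $a\cdot 0=0\cdot a=0$ for all $a$. For a semigroup $(S,+)$, $M(S)$ is the near-semiring of all maps $S\to S$ with $x(f+g)=xf+xg$ and $x(fg)=(xf)g$. An affine map on $S$ is a map $g+h$ with $g$ an endomorphism of $(S,+)$ and $h$ a constant map on $S$. $A^+(S)$ is the subnear-semiring of $M(S)$ generated by all affine maps. The Brandt semigroup is $B_n=([n]\times[n])\cup\{\vartheta\}$, $[n]=\{1,\dots,n\}$, with $(i,j)+(k,l)=(i,l)$ if $j=k$ and $=\vartheta$ if $j\ne k$, and $\alpha+\vartheta=\vartheta+\alpha=\vartheta$ for all $\alpha\in B_n$. $\mathcal{N}=A^+(B_n)\cup\{0\}$, where $0$ is a new element adjoined to $A^+(B_n)$ with $0+f=f+0=f$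 and $0f=f0=0$ for all $f\in\mathcal{N}$; it is a zero-symmetric near-semiring. A congruence of the near-semiring $\mathcal{N}$ is an equivalence relation on $\mathcal{N}$ that is compatible (on both sides) with both $+$ and the multiplication. An ideal of $\mathcal{N}$ is the kernel of a homomorphism $\phi$ from $\mathcal{N}$ to a zero-symmetric near-semiring, i.e. the set of elements mapped to the zero of the target, where homomorphisms preserve $+$, the multiplication and $0$. *)

theory Defs
  imports "HOL-Library.FuncSet"
begin

section \<open>Near-semirings\<close>

record 'a near_semiring_struct =
  carrier :: "'a set"
  add :: "'a \<Rightarrow> 'a \<Rightarrow> 'a"  (infixl \<open>\<oplus>\<index>\<close> 65)
  mult :: "'a \<Rightarrow> 'a \<Rightarrow> 'a"  (infixl \<open>\<odot>\<index>\<close> 70)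

record 'a near_semiring0_struct = "'a near_semiring_struct" +
  zero :: 'a  (\<open>\<zero>\<index>\<close>)

locale near_semiring =
  fixes M (structure)
  assumes add_closed: "\<lbrakk>a \<in> carrier M; b \<in> carrier M\<rbrakk> \<Longrightarrow> a \<oplus> b \<in> carrier M"
    and mult_closed: "\<lbrakk>a \<in> carrier M; b \<in> carrier M\<rbrakk> \<Longrightarrow> a \<odot> b \<in> carrier M"
    and add_assoc: "\<lbrakk>a \<in> carrier M; b \<in> carrier M; c \<in> carrier M\<rbrakk>
      \<Longrightarrow> (a \<oplus> b) \<oplus> c = a \<oplus> (b \<oplus> c)"
    and mult_assoc: "\<lbrakk>a \<in> carrier M; b \<in> carrier M; c \<in> carrier M\<rbrakk>
      \<Longrightarrow> (a \<odot> b) \<odot> c = a \<odot> (b \<odot> c)"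
    and distrib: "\<lbrakk>a \<in> carrier M; b \<in> carrier M; c \<in> carrier M\<rbrakk>
      \<Longrightarrow> a \<odot> (b \<oplus> c) = a \<odot> b \<oplus> a \<odot> c"

locale zero_symmetric_near_semiring = near_semiring +
  assumes zero_closed: "\<zero> \<in> carrier M"
    and add_zero: "a \<in> carrier M \<Longrightarrow> a \<oplus> \<zero> = a"
    and zero_add: "a \<in> carrier M \<Longrightarrow> \<zero> \<oplus> a = a"
    and mult_zero: "a \<in> carrier M \<Longrightarrow> a \<odot> \<zero> = \<zero>"
    and zero_mult: "a \<in> carrier M \<Longrightarrow> \<zero> \<odot> a = \<zero>"

inductive_set generated ::
    "('a, 'm) near_semiring_struct_scheme \<Rightarrow> 'a set \<Rightarrow> 'a set"
  for M (structure) and X where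
  base: "x \<in> X \<Longrightarrow> x \<in> generated M X"
| add: "\<lbrakk>x \<in> generated M X; y \<in> generated M X\<rbrakk> \<Longrightarrow> x \<oplus> y \<in> generated M X"
| mult: "\<lbrakk>x \<in> generated M X; y \<in> generated M X\<rbrakk> \<Longrightarrow> x \<odot> y \<in> generated M X"

definition congruence ::
    "('a, 'm) near_semiring_struct_scheme \<Rightarrow> ('a \<times> 'a) set \<Rightarrow> bool" where
  "congruence M R \<longleftrightarrow> equiv (carrier M) R \<and>
     (\<forall>(a, b) \<in> R. \<forall>c \<in> carrier M.
        (a \<oplus>\<^bsub>M\<^esub> c, b \<oplus>\<^bsub>M\<^esub> c) \<in> R \<and> (c \<oplus>\<^bsub>M\<^esub> a, c \<oplus>\<^bsub>M\<^esub> b) \<in> R \<and>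
        (a \<odot>\<^bsub>M\<^esub> c, b \<odot>\<^bsub>M\<^esub> c) \<in> R \<and> (c \<odot>\<^bsub>M\<^esub> a, c \<odot>\<^bsub>M\<^esub> b) \<in> R)"

definition hom0 :: "('a, 'm) near_semiring0_struct_scheme \<Rightarrow>
    ('b, 'k) near_semiring0_struct_scheme \<Rightarrow> ('a \<Rightarrow> 'b) set" where
  "hom0 M T = {\<phi>. \<phi> \<in> carrier M \<rightarrow> carrier T \<and> \<phi> \<zero>\<^bsub>M\<^esub> = \<zero>\<^bsub>T\<^esub> \<and>
     (\<forall>a \<in> carrier M. \<forall>b \<in> carrier M.
        \<phi> (a \<oplus>\<^bsub>M\<^esub> b) = \<phi> a \<oplus>\<^bsub>T\<^esub> \<phi> b \<and> \<phi> (a \<odot>\<^bsub>M\<^esub> b) = \<phi> a \<odot>\<^bsub>T\<^esub> \<phi> b)}"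

definition ker0 :: "('a, 'm) near_semiring0_struct_scheme \<Rightarrow>
    ('b, 'k) near_semiring0_struct_scheme \<Rightarrow> ('a \<Rightarrow> 'b) \<Rightarrow> 'a set" where
  "ker0 M T \<phi> = {x \<in> carrier M. \<phi> x = \<zero>\<^bsub>T\<^esub>}"

text \<open>
  A definition cannot quantify over the type of the target. Taking targets over the type
  of the domain loses nothing, since the image of a homomorphism can be carried by a set of
  representatives of its fibres: see \<open>ideal_ker0\<close> below.
\<close>

definition ideal :: "'a near_semiring0_struct \<Rightarrow> 'a set \<Rightarrow> bool" where
  "ideal M I \<longleftrightarrow> (\<exists>(T :: 'a near_semiring0_struct) \<phi>.
     zero_symmetric_near_semiring T \<and> \<phi> \<in> hom0 M T \<and> I = ker0 M T \<phi>)"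

lemma ideal_ker0:
  fixes M :: "'a near_semiring0_struct" and T :: "('b, 'k) near_semiring0_struct_scheme"
  assumes M: "zero_symmetric_near_semiring M" and T: "zero_symmetric_near_semiring T"
    and \<phi>: "\<phi> \<in> hom0 M T"
  shows "ideal M (ker0 M T \<phi>)"
proof -
  interpret M: zero_symmetric_near_semiring M by (rule M)
  interpret T: zero_symmetric_near_semiring T by (rule T)
  define \<psi> where "\<psi> = inv_into (carrier M) \<phi>"
  define U :: "'a near_semiring0_struct" where
    "U = \<lparr>carrier = \<psi> ` \<phi> ` carrier M,
       add = (\<lambda>x y. \<psi> (\<phi> x \<oplus>\<^bsub>T\<^esub> \<phi> y)), mult = (\<lambda>x y. \<psi> (\<phi> x \<odot>\<^bsub>T\<^esub> \<phi> y)),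
       zero = \<psi> \<zero>\<^bsub>T\<^esub>\<rparr>"
  have inv: "\<phi> (\<psi> b) = b" if "b \<in> \<phi> ` carrier M" for b
    using that by (simp add: \<psi>_def f_inv_into_f)
  have sub: "\<phi> ` carrier M \<subseteq> carrier T"
    using \<phi> by (auto simp: hom0_def)
  have zero: "\<zero>\<^bsub>T\<^esub> \<in> \<phi> ` carrier M"
    using \<phi> M.zero_closed by (auto simp: hom0_def intro!: image_eqI[of _ _ "\<zero>\<^bsub>M\<^esub>"])
  have cl_add: "b \<oplus>\<^bsub>T\<^esub> c \<in> \<phi> ` carrier M"
    and cl_mult: "b \<odot>\<^bsub>T\<^esub> c \<in> \<phi> ` carrier M"
    if bc: "b \<in> \<phi> ` carrier M" "c \<in> \<phi> ` carrier M" for b c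
  proof -
    from bc obtain x y where xy: "b = \<phi> x" "c = \<phi> y" "x \<in> carrier M" "y \<in> carrier M"
      by auto
    have "b \<oplus>\<^bsub>T\<^esub> c = \<phi> (x \<oplus>\<^bsub>M\<^esub> y)" "b \<odot>\<^bsub>T\<^esub> c = \<phi> (x \<odot>\<^bsub>M\<^esub> y)"
      using xy \<phi> by (simp_all add: hom0_def)
    then show "b \<oplus>\<^bsub>T\<^esub> c \<in> \<phi> ` carrier M" "b \<odot>\<^bsub>T\<^esub> c \<in> \<phi> ` carrier M"
      using xy M.add_closed M.mult_closed by auto
  qed
  have inT: "\<phi> x \<in> carrier T" if "x \<in> carrier M" for x
    using that sub by auto
  note cl = cl_add cl_mult zero
  have U: "zero_symmetric_near_semiring U"
    by unfold_locales
      (auto simp: U_def inv cl inT T.add_assoc T.mult_assoc T.distrib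
        T.add_zero T.zero_add T.mult_zero T.zero_mult)
  have hom: "\<psi> \<circ> \<phi> \<in> hom0 M U"
    using \<phi> by (auto simp: hom0_def U_def inv)
  have "ker0 M T \<phi> = ker0 M U (\<psi> \<circ> \<phi>)"
    using inv zero by (auto simp: ker0_def U_def) (metis imageI inv)
  with U hom show ?thesis
    unfolding ideal_def by blast
qed

definition adjoin_zero ::
    "'a near_semiring_struct \<Rightarrow> 'a option near_semiring0_struct" where
  "adjoin_zero M =
     \<lparr>carrier = insert None (Some ` carrier M),
      add = (\<lambda>f g. case f of None \<Rightarrow> g | Some x \<Rightarrow>
               (case g of None \<Rightarrow> f | Some y \<Rightarrow> Some (x \<oplus>\<^bsub>M\<^esub> y))),
      mult = (\<lambda>f g. case f of None \<Rightarrow> None | Some x \<Rightarrow>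
               (case g of None \<Rightarrow> None | Some y \<Rightarrow> Some (x \<odot>\<^bsub>M\<^esub> y))),
      zero = None\<rparr>"

section \<open>Affine near-semirings\<close>

text \<open>
  A semigroup is given by its carrier \<open>S\<close> and operation \<open>p\<close>; maps on \<open>S\<close> are extensional
  functions, so that equality of maps is equality on \<open>S\<close>. Arguments of maps are written on
  the left, so the product \<open>fg\<close> applies \<open>f\<close> first.
\<close>

definition maps :: "'a set \<Rightarrow> ('a \<Rightarrow> 'a \<Rightarrow> 'a) \<Rightarrow> ('a \<Rightarrow> 'a) near_semiring_struct" where
  "maps S p =
     \<lparr>carrier = S \<rightarrow>\<^sub>E S,
      add = (\<lambda>f g. \<lambda>x\<in>S. p (f x) (g x)),
      mult = (\<lambda>f g. compose S g f)\<rparr>"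

definition endomorphisms :: "'a set \<Rightarrow> ('a \<Rightarrow> 'a \<Rightarrow> 'a) \<Rightarrow> ('a \<Rightarrow> 'a) set" where
  "endomorphisms S p = {g \<in> S \<rightarrow>\<^sub>E S. \<forall>x \<in> S. \<forall>y \<in> S. g (p x y) = p (g x) (g y)}"

definition constant_maps :: "'a set \<Rightarrow> ('a \<Rightarrow> 'a) set" where
  "constant_maps S = {\<lambda>x\<in>S. c | c. c \<in> S}"

definition affine_maps :: "'a set \<Rightarrow> ('a \<Rightarrow> 'a \<Rightarrow> 'a) \<Rightarrow> ('a \<Rightarrow> 'a) set" where
  "affine_maps S p = {g \<oplus>\<^bsub>maps S p\<^esub> h | g h. g \<in> endomorphisms S p \<and> h \<in> constant_maps S}"

definition affine_near_semiring ::
    "'a set \<Rightarrow> ('a \<Rightarrow> 'a \<Rightarrow> 'a) \<Rightarrow> ('a \<Rightarrow> 'a) near_semiring_struct" where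
  "affine_near_semiring S p =
     (maps S p)\<lparr>carrier := generated (maps S p) (affine_maps S p)\<rparr>"

section \<open>Brandt semigroups\<close>

datatype brandt = Elem nat nat | Theta (\<open>\<vartheta>\<close>)

definition brandt_carrier :: "nat \<Rightarrow> brandt set" where
  "brandt_carrier n = {Elem i j | i j. i \<in> {1..n} \<and> j \<in> {1..n}} \<union> {\<vartheta>}"

fun brandt_add :: "brandt \<Rightarrow> brandt \<Rightarrow> brandt" where
  "brandt_add (Elem i j) (Elem k l) = (if j = k then Elem i l else \<vartheta>)"
| "brandt_add \<vartheta> _ = \<vartheta>"
| "brandt_add _ \<vartheta> = \<vartheta>"

definition affine_brandt :: "nat \<Rightarrow> (brandt \<Rightarrow> brandt) near_semiring_struct" where
  "affine_brandt n = affine_near_semiring (brandt_carrier n) brandt_add"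

definition affine_brandt0 :: "nat \<Rightarrow> (brandt \<Rightarrow> brandt) option near_semiring0_struct" where
  "affine_brandt0 n = adjoin_zero (affine_brandt n)"

lemma brandt_add_closed:
  "\<lbrakk>a \<in> brandt_carrier n; b \<in> brandt_carrier n\<rbrakk> \<Longrightarrow> brandt_add a b \<in> brandt_carrier n"
  by (cases a; cases b) (auto simp: brandt_carrier_def)

lemma brandt_add_assoc: "brandt_add (brandt_add a b) c = brandt_add a (brandt_add b c)"
  by (cases a; cases b; cases c) auto

lemma affine_brandt_maps:
  "carrier (affine_brandt n) \<subseteq> brandt_carrier n \<rightarrow>\<^sub>E brandt_carrier n"
proof
  fix f assume "f \<in> carrier (affine_brandt n)"
  then have "f \<in> generated (maps (brandt_carrier n) brandt_add)
      (affine_maps (brandt_carrier n) brandt_add)"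
    by (simp add: affine_brandt_def affine_near_semiring_def)
  then show "f \<in> brandt_carrier n \<rightarrow>\<^sub>E brandt_carrier n"
  proof induction
    case (base f)
    then show ?case
      by (auto simp: affine_maps_def maps_def endomorphisms_def constant_maps_def
          intro!: brandt_add_closed)
  next
    case (add f g)
    then show ?case by (auto simp: maps_def intro!: brandt_add_closed)
  next
    case (mult f g)
    then show ?case by (auto simp: maps_def compose_def)
  qed
qed

lemma near_semiring_affine_brandt: "near_semiring (affine_brandt n)"
proof
  fix f g h
  assume fgh: "f \<in> carrier (affine_brandt n)" "g \<in> carrier (affine_brandt n)"
    "h \<in> carrier (affine_brandt n)"
  then have [simp]: "x \<in> brandt_carrier n \<Longrightarrow> f x \<in> brandt_carrier n"
    "x \<in> brandt_carrier n \<Longrightarrow> g x \<in> brandt_carrier n" for x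
    using affine_brandt_maps by blast+
  show "(f \<oplus>\<^bsub>affine_brandt n\<^esub> g) \<oplus>\<^bsub>affine_brandt n\<^esub> h =
      f \<oplus>\<^bsub>affine_brandt n\<^esub> (g \<oplus>\<^bsub>affine_brandt n\<^esub> h)"
    by (auto simp: affine_brandt_def affine_near_semiring_def maps_def brandt_add_assoc)
  show "(f \<odot>\<^bsub>affine_brandt n\<^esub> g) \<odot>\<^bsub>affine_brandt n\<^esub> h =
      f \<odot>\<^bsub>affine_brandt n\<^esub> (g \<odot>\<^bsub>affine_brandt n\<^esub> h)"
    by (auto simp: affine_brandt_def affine_near_semiring_def maps_def compose_def)
  show "f \<odot>\<^bsub>affine_brandt n\<^esub> (g \<oplus>\<^bsub>affine_brandt n\<^esub> h) =
      f \<odot>\<^bsub>affine_brandt n\<^esub> g \<oplus>\<^bsub>affine_brandt n\<^esub> f \<odot>\<^bsub>affine_brandt n\<^esub> h"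
    by (auto simp: affine_brandt_def affine_near_semiring_def maps_def compose_def)
qed (auto simp: affine_brandt_def affine_near_semiring_def intro: generated.add generated.mult)

lemma zero_symmetric_affine_brandt0: "zero_symmetric_near_semiring (affine_brandt0 n)"
proof -
  interpret near_semiring "affine_brandt n" by (rule near_semiring_affine_brandt)
  show ?thesis
    by unfold_locales
      (auto simp: affine_brandt0_def adjoin_zero_def add_closed mult_closed add_assoc
        mult_assoc distrib)
qed

end

theory Submission
  imports Defs
begin

text \<open>
  Everything is decided by the constant maps. All of them are affine, they form a copy of the
  Brandt semigroup, and multiplying a map \<open>f\<close> by the constant \<open>x\<close> from the left gives the
  constant \<open>xf\<close>. So a congruence that identifies two different maps already identifies two
  different constants (\<open>values_related\<close>). The Brandt semigroup has no congruences besides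
  equality and the full relation: adding \<open>(p,p)\<close> on the left or \<open>(q,q)\<close> on the right
  keeps \<open>(p,q)\<close>, and one of the two sends a given different element to \<open>\<vartheta>\<close>. So
  \<open>(p,q)\<close> is related to \<open>\<vartheta>\<close>, and by adding suitable elements on both sides so is
  everything else. Hence all constants are identified (\<open>brandt_simple\<close>).

  To pass from constants to arbitrary maps, note that an affine map ends by adding a constant,
  \<open>(a,b)\<close> or \<open>\<vartheta>\<close>. In the first case its values are \<open>\<vartheta>\<close> or lie in
  column \<open>b\<close>, and it is fixed by adding the constant \<open>(b,b)\<close> on the right; in the second
  case it is the constant \<open>\<vartheta>\<close>, and any \<open>b\<close> will do. This survives sums and
  products, because both inherit the column of their right-hand factor
  (\<open>right_identity\<close>). If all constants are identified, then every \<open>f = f + (b,b)\<close> is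
  identified with \<open>f + \<vartheta> = \<vartheta>\<close>. Finally, if the new zero is related to some map,
  multiplying by the constant \<open>\<vartheta>\<close> shows that it is related to this constant. Since zero
  is additively neutral, every \<open>f = f + 0\<close> is then related to \<open>f + \<vartheta> = \<vartheta>\<close>, and
  the congruence is total.

  An ideal is the class of zero under the congruence induced by a homomorphism, and these classes
  can be read off from the list of congruences.
\<close>

section \<open>Congruences and ideals of zero-symmetric near-semirings\<close>

lemma congruence_Id_on:
  assumes "near_semiring M"
  shows "congruence M (Id_on (carrier M))"
proof -
  interpret near_semiring M by (rule assms)
  show ?thesis
    by (auto simp: congruence_def add_closed mult_closed Id_on_def
        intro!: equivI refl_onI symI transI)
qed

lemma congruence_full:
  assumes "near_semiring M"
  shows "congruence M (carrier M \<times> carrier M)"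
proof -
  interpret near_semiring M by (rule assms)
  show ?thesis
    by (auto simp: congruence_def add_closed mult_closed
        intro!: equivI refl_onI symI transI)
qed

text \<open>
  Sums and products of elements of \<open>M\<close> are never the adjoined zero, so collapsing
  \<open>M\<close> to a point is compatible with both operations.
\<close>

lemma congruence_adjoin_zero_collapse:
  assumes "near_semiring M"
  shows "congruence (adjoin_zero M)
    ((Some ` carrier M \<times> Some ` carrier M) \<union> {(None, None)})"
proof -
  interpret near_semiring M by (rule assms)
  show ?thesis
    by (auto simp: congruence_def adjoin_zero_def add_closed mult_closed
        intro!: equivI refl_onI symI transI)
qed

lemma ideal_zero_class:
  assumes M: "zero_symmetric_near_semiring M" and I: "ideal M I"
  obtains R where "congruence M R" "I = R `` {\<zero>\<^bsub>M\<^esub>}"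
proof -
  interpret zero_symmetric_near_semiring M by (rule M)
  obtain T :: "'a near_semiring0_struct" and \<phi> where \<phi>: "\<phi> \<in> hom0 M T" "I = ker0 M T \<phi>"
    using I unfolding ideal_def by blast
  define R where "R = {(x, y). x \<in> carrier M \<and> y \<in> carrier M \<and> \<phi> x = \<phi> y}"
  have "congruence M R"
    using \<phi>(1) by (auto simp: congruence_def R_def hom0_def add_closed mult_closed
        intro!: equivI refl_onI symI transI)
  moreover have "I = R `` {\<zero>\<^bsub>M\<^esub>}"
    using \<phi> zero_closed by (auto simp: R_def hom0_def ker0_def)
  ultimately show thesis by (rule that)
qed

lemma ideal_zero:
  assumes "zero_symmetric_near_semiring M"
  shows "ideal M {\<zero>\<^bsub>M\<^esub>}"
proof -
  interpret zero_symmetric_near_semiring M by (rule assms)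
  have "(\<lambda>x. x) \<in> hom0 M M" "ker0 M M (\<lambda>x. x) = {\<zero>\<^bsub>M\<^esub>}"
    by (auto simp: hom0_def ker0_def zero_closed)
  then show ?thesis using ideal_ker0[OF assms assms] by metis
qed

lemma ideal_carrier:
  assumes "zero_symmetric_near_semiring M"
  shows "ideal M (carrier M)"
proof -
  define T :: "unit near_semiring0_struct" where
    "T = \<lparr>carrier = UNIV, add = (\<lambda>_ _. ()), mult = (\<lambda>_ _. ()), zero = ()\<rparr>"
  have "zero_symmetric_near_semiring T"
    by unfold_locales (auto simp: T_def)
  moreover have "(\<lambda>_. ()) \<in> hom0 M T" "ker0 M T (\<lambda>_. ()) = carrier M"
    by (auto simp: hom0_def ker0_def T_def)
  ultimately show ?thesis using ideal_ker0[OF assms] by metis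
qed

section \<open>Constant maps on the Brandt semigroup\<close>

abbreviation const_map :: "nat \<Rightarrow> brandt \<Rightarrow> brandt \<Rightarrow> brandt" where
  "const_map n a \<equiv> \<lambda>x\<in>brandt_carrier n. a"

lemma brandt_add_Theta [simp]: "brandt_add a \<vartheta> = \<vartheta>"
  by (cases a) auto

lemma Theta_carrier [simp]: "\<vartheta> \<in> brandt_carrier n"
  by (simp add: brandt_carrier_def)

lemma Elem_carrier [simp]: "Elem i j \<in> brandt_carrier n \<longleftrightarrow> i \<in> {1..n} \<and> j \<in> {1..n}"
  by (auto simp: brandt_carrier_def)

lemma affine_brandt_add:
  "add (affine_brandt n) f g = (\<lambda>x\<in>brandt_carrier n. brandt_add (f x) (g x))"
  by (simp add: affine_brandt_def affine_near_semiring_def maps_def)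

lemma affine_brandt_mult:
  "mult (affine_brandt n) f g = compose (brandt_carrier n) g f"
  by (simp add: affine_brandt_def affine_near_semiring_def maps_def)

lemma carrier_affine_brandt:
  "carrier (affine_brandt n) =
     generated (maps (brandt_carrier n) brandt_add) (affine_maps (brandt_carrier n) brandt_add)"
  by (simp add: affine_brandt_def affine_near_semiring_def)

text \<open>
  Each element \<open>a\<close> has an idempotent left identity \<open>e\<close> (\<open>(i,i)\<close> for \<open>(i,j)\<close>,
  and \<open>\<vartheta>\<close> for \<open>\<vartheta>\<close>). The constant map \<open>e\<close> is an endomorphism, and adding the
  constant \<open>a\<close> to it yields the constant \<open>a\<close>.
\<close>

lemma const_map_affine:
  assumes "a \<in> brandt_carrier n"
  shows "const_map n a \<in> carrier (affine_brandt n)"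
proof -
  obtain e where e: "e \<in> brandt_carrier n" "brandt_add e e = e" "brandt_add e a = a"
  proof (cases a)
    case (Elem i j)
    then show thesis using assms that[of "Elem i i"] by simp
  next
    case Theta
    then show thesis using that[of \<vartheta>] by simp
  qed
  let ?M = "maps (brandt_carrier n) brandt_add"
  have "const_map n e \<in> endomorphisms (brandt_carrier n) brandt_add"
    using e by (auto simp: endomorphisms_def brandt_add_closed)
  moreover have "const_map n a \<in> constant_maps (brandt_carrier n)"
    using assms by (auto simp: constant_maps_def)
  moreover have "const_map n a = const_map n e \<oplus>\<^bsub>?M\<^esub> const_map n a"
    using e by (auto simp: maps_def)
  ultimately have "const_map n a \<in> affine_maps (brandt_carrier n) brandt_add"
    unfolding affine_maps_def by blast
  then show ?thesis
    by (simp add: carrier_affine_brandt generated.base)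
qed

text \<open>
  All values of an affine map other than \<open>\<vartheta>\<close> lie in the column of the constant
  added last; a sum takes its column from the right summand and a product \<open>fg\<close> from \<open>g\<close>, which is applied last.
\<close>

lemma right_identity:
  assumes n: "n \<ge> 1" and f: "f \<in> carrier (affine_brandt n)"
  shows "\<exists>q\<in>{1..n}. f \<oplus>\<^bsub>affine_brandt n\<^esub> const_map n (Elem q q) = f"
proof -
  let ?S = "brandt_carrier n"
  have "\<exists>q\<in>{1..n}. \<forall>x\<in>?S. brandt_add (f x) (Elem q q) = f x"
    using f unfolding carrier_affine_brandt
  proof induction
    case (base f)
    then obtain g a where f: "f = (\<lambda>x\<in>?S. brandt_add (g x) a)" and a: "a \<in> ?S"
      by (auto simp: affine_maps_def maps_def constant_maps_def cong: restrict_cong)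
    \<comment> \<open>The element \<open>\<vartheta>\<close> is fixed by adding any \<open>(q,q)\<close>; column 1 exists because \<open>n \<ge> 1\<close>.\<close>
    have "\<exists>q\<in>{1..n}. brandt_add a (Elem q q) = a"
      using a n by (cases a) (auto intro: bexI[of _ 1])
    then show ?case by (simp add: f brandt_add_assoc) metis
  next
    case (add f g)
    from add.IH(2) show ?case by (simp add: maps_def brandt_add_assoc) metis
  next
    case (mult f g)
    then have "f x \<in> ?S" if "x \<in> ?S" for x
      using that affine_brandt_maps[of n] by (auto simp: carrier_affine_brandt)
    with mult show ?case by (auto simp: maps_def compose_def)
  qed
  moreover have "f \<in> extensional ?S"
    using f affine_brandt_maps[of n] by (auto simp: PiE_def)
  ultimately show ?thesis
    by (auto simp: affine_brandt_add intro!: bexI extensionalityI[where A = ?S])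
qed

lemma add_const_Theta:
  "f \<oplus>\<^bsub>affine_brandt n\<^esub> const_map n \<vartheta> = const_map n \<vartheta>"
  by (auto simp: affine_brandt_add)

text \<open>
  If \<open>(p,q)\<close> is related to \<open>(r,s)\<close> with \<open>r \<noteq> p\<close>, adding \<open>(p,p)\<close> on the left relates
  \<open>(p,q)\<close> to \<open>\<vartheta>\<close>; if \<open>s \<noteq> q\<close>, adding \<open>(q,q)\<close> on the right does. Then
  \<open>(i,j) = (i,p) + (p,q) + (q,j)\<close> is related to \<open>\<vartheta>\<close> as well.
\<close>

lemma brandt_simple:
  assumes R: "equiv (brandt_carrier n) R"
    and left: "\<And>a b c. \<lbrakk>(a, b) \<in> R; c \<in> brandt_carrier n\<rbrakk>
      \<Longrightarrow> (brandt_add c a, brandt_add c b) \<in> R"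
    and right: "\<And>a b c. \<lbrakk>(a, b) \<in> R; c \<in> brandt_carrier n\<rbrakk>
      \<Longrightarrow> (brandt_add a c, brandt_add b c) \<in> R"
    and ab: "(a, b) \<in> R" "a \<noteq> b"
    and c: "c \<in> brandt_carrier n"
  shows "(c, \<vartheta>) \<in> R"
proof -
  have sym: "(y, x) \<in> R" if "(x, y) \<in> R" for x y
    using R that by (meson equivE symD)
  have sub: "R \<subseteq> brandt_carrier n \<times> brandt_carrier n"
    using R by (rule equiv_type)
  have refl: "(\<vartheta>, \<vartheta>) \<in> R"
    using R by (meson Theta_carrier equivE refl_onD)
  have separate: "\<exists>p q. (Elem p q, \<vartheta>) \<in> R" if xy: "(Elem p q, y) \<in> R" "Elem p q \<noteq> y" for p q y
  proof (cases y)
    case (Elem r s)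
    have pq: "Elem p p \<in> brandt_carrier n" "Elem q q \<in> brandt_carrier n"
      using xy(1) sub by auto
    show ?thesis
      using left[OF xy(1) pq(1)] right[OF xy(1) pq(2)] xy(2) Elem
      by (auto split: if_splits)
  qed (use xy in auto)
  obtain p q where pq: "(Elem p q, \<vartheta>) \<in> R"
  proof (cases a)
    case (Elem i j)
    then show thesis using separate[of i j b] ab that by blast
  next
    case Theta
    then obtain i j where "b = Elem i j" using ab(2) by (cases b) auto
    then show thesis using sym[OF ab(1)] Theta that by blast
  qed
  show ?thesis
  proof (cases c)
    case (Elem i j)
    have "Elem i p \<in> brandt_carrier n" "Elem q j \<in> brandt_carrier n"
      using c Elem pq sub by auto
    then show ?thesis
      using right[OF left[OF pq, of "Elem i p"], of "Elem q j"] Elem by simp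
  qed (use refl in simp)
qed

section \<open>Congruences of the affine near-semiring over the Brandt semigroup\<close>

lemma affine_brandt0_simps:
  "carrier (affine_brandt0 n) = insert None (Some ` carrier (affine_brandt n))"
  "\<zero>\<^bsub>affine_brandt0 n\<^esub> = None"
  "Some f \<oplus>\<^bsub>affine_brandt0 n\<^esub> Some g = Some (f \<oplus>\<^bsub>affine_brandt n\<^esub> g)"
  "Some f \<odot>\<^bsub>affine_brandt0 n\<^esub> Some g = Some (f \<odot>\<^bsub>affine_brandt n\<^esub> g)"
  "x \<oplus>\<^bsub>affine_brandt0 n\<^esub> None = x"
  "None \<oplus>\<^bsub>affine_brandt0 n\<^esub> x = x"
  "x \<odot>\<^bsub>affine_brandt0 n\<^esub> None = None"
  "None \<odot>\<^bsub>affine_brandt0 n\<^esub> x = None"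
  by (auto simp: affine_brandt0_def adjoin_zero_def split: option.split)

locale affine_brandt0_congruence =
  fixes n :: nat and R :: "((brandt \<Rightarrow> brandt) option \<times> (brandt \<Rightarrow> brandt) option) set"
  assumes n: "n \<ge> 1" and R: "congruence (affine_brandt0 n) R"
begin

lemma equiv_R: "equiv (carrier (affine_brandt0 n)) R"
  using R by (simp add: congruence_def)

lemma R_sym: "(a, b) \<in> R \<Longrightarrow> (b, a) \<in> R"
  using equiv_R by (meson equivE symD)

lemma R_trans: "(a, b) \<in> R \<Longrightarrow> (b, c) \<in> R \<Longrightarrow> (a, c) \<in> R"
  using equiv_R by (meson equivE transD)

lemma R_refl: "a \<in> carrier (affine_brandt0 n) \<Longrightarrow> (a, a) \<in> R"
  using equiv_R by (meson equivE refl_onD)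

lemma R_carrier: "(a, b) \<in> R \<Longrightarrow> a \<in> carrier (affine_brandt0 n) \<and> b \<in> carrier (affine_brandt0 n)"
  using equiv_type[OF equiv_R] by blast

lemma R_compat:
  assumes "(a, b) \<in> R" "c \<in> carrier (affine_brandt0 n)"
  shows "(a \<oplus>\<^bsub>affine_brandt0 n\<^esub> c, b \<oplus>\<^bsub>affine_brandt0 n\<^esub> c) \<in> R"
    "(c \<oplus>\<^bsub>affine_brandt0 n\<^esub> a, c \<oplus>\<^bsub>affine_brandt0 n\<^esub> b) \<in> R"
    "(a \<odot>\<^bsub>affine_brandt0 n\<^esub> c, b \<odot>\<^bsub>affine_brandt0 n\<^esub> c) \<in> R"
    "(c \<odot>\<^bsub>affine_brandt0 n\<^esub> a, c \<odot>\<^bsub>affine_brandt0 n\<^esub> b) \<in> R"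
  using R assms by (auto simp: congruence_def)

definition const_rel :: "(brandt \<times> brandt) set" where
  "const_rel = {(a, b). a \<in> brandt_carrier n \<and> b \<in> brandt_carrier n \<and>
     (Some (const_map n a), Some (const_map n b)) \<in> R}"

lemma Some_const_map_carrier:
  "a \<in> brandt_carrier n \<Longrightarrow> Some (const_map n a) \<in> carrier (affine_brandt0 n)"
  by (simp add: affine_brandt0_simps const_map_affine)

lemma equiv_const_rel: "equiv (brandt_carrier n) const_rel"
  by (auto simp: const_rel_def intro!: equivI refl_onI symI transI
      intro: R_refl R_sym R_trans Some_const_map_carrier)

lemma const_map_add:
  "Some (const_map n a) \<oplus>\<^bsub>affine_brandt0 n\<^esub> Some (const_map n b) =
     Some (const_map n (brandt_add a b))"
  by (auto simp: affine_brandt0_simps affine_brandt_add)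

lemma const_rel_compat:
  assumes "(a, b) \<in> const_rel" "c \<in> brandt_carrier n"
  shows "(brandt_add c a, brandt_add c b) \<in> const_rel"
    "(brandt_add a c, brandt_add b c) \<in> const_rel"
  using assms R_compat(1,2)[of "Some (const_map n a)" "Some (const_map n b)" "Some (const_map n c)"]
  by (auto simp: const_rel_def const_map_add brandt_add_closed Some_const_map_carrier)

text \<open>
  Applying the constant \<open>x\<close> first and then \<open>f\<close> gives the constant \<open>xf\<close>, so a point at
  which two related maps differ yields two different related constants.
\<close>

lemma values_related:
  assumes fg: "(Some f, Some g) \<in> R" and x: "x \<in> brandt_carrier n"
  shows "(f x, g x) \<in> const_rel"
proof -
  have eq: "Some (const_map n x) \<odot>\<^bsub>affine_brandt0 n\<^esub> Some h = Some (const_map n (h x))" for h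
    using x by (auto simp: affine_brandt0_simps affine_brandt_mult compose_def)
  have "f \<in> carrier (affine_brandt n)" "g \<in> carrier (affine_brandt n)"
    using R_carrier[OF fg] by (auto simp: affine_brandt0_simps)
  then have "f x \<in> brandt_carrier n" "g x \<in> brandt_carrier n"
    using x affine_brandt_maps by blast+
  with R_compat(4)[OF fg Some_const_map_carrier[OF x]] show ?thesis
    by (simp add: const_rel_def eq)
qed

text \<open>
  A map \<open>f\<close> equals \<open>f + (q,q)\<close> for a suitable \<open>q\<close>, and \<open>f + \<vartheta> = \<vartheta>\<close>; so the
  collapse of the constants spreads to all maps.
\<close>

lemma distinct_maps_collapse:
  assumes fg: "(Some f, Some g) \<in> R" "f \<noteq> g" and h: "h \<in> carrier (affine_brandt n)"
  shows "(Some h, Some (const_map n \<vartheta>)) \<in> R"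
proof -
  have "f \<in> extensional (brandt_carrier n)" "g \<in> extensional (brandt_carrier n)"
    using R_carrier[OF fg(1)] affine_brandt_maps[of n] by (auto simp: affine_brandt0_simps PiE_def)
  then obtain x where "x \<in> brandt_carrier n" "f x \<noteq> g x"
    using fg(2) by (meson extensionalityI)
  then have const: "(c, \<vartheta>) \<in> const_rel" if "c \<in> brandt_carrier n" for c
    using brandt_simple[OF equiv_const_rel const_rel_compat values_related[OF fg(1)]] that by blast
  obtain q where q: "q \<in> {1..n}" "h \<oplus>\<^bsub>affine_brandt n\<^esub> const_map n (Elem q q) = h"
    using right_identity[OF n h] by blast
  have "(Some (const_map n (Elem q q)), Some (const_map n \<vartheta>)) \<in> R"
    using const[of "Elem q q"] q(1) by (simp add: const_rel_def)
  from R_compat(2)[OF this, of "Some h"] show ?thesis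
    using h q(2) by (simp add: affine_brandt0_simps add_const_Theta)
qed

text \<open>
  If \<open>f\<close> is related to \<open>0\<close>, multiply by the constant \<open>\<vartheta>\<close> on the right, which turns
  \<open>f\<close> into that constant and fixes \<open>0\<close>; then add any map on the left.
\<close>

lemma zero_related_full:
  assumes f: "(Some f, None) \<in> R"
  shows "R = carrier (affine_brandt0 n) \<times> carrier (affine_brandt0 n)"
proof -
  let ?t = "Some (const_map n \<vartheta>)"
  have "f \<in> carrier (affine_brandt n)"
    using R_carrier[OF f] by (auto simp: affine_brandt0_simps)
  then have "f x \<in> brandt_carrier n" if "x \<in> brandt_carrier n" for x
    using that affine_brandt_maps by blast
  then have "f \<odot>\<^bsub>affine_brandt n\<^esub> const_map n \<vartheta> = const_map n \<vartheta>"
    by (auto simp: affine_brandt_mult compose_def)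
  with R_compat(3)[OF f Some_const_map_carrier[OF Theta_carrier]] have t: "(?t, None) \<in> R"
    by (simp add: affine_brandt0_simps)
  have all: "(x, None) \<in> R" if x: "x \<in> carrier (affine_brandt0 n)" for x
  proof (cases x)
    case None
    then show ?thesis using R_refl x by simp
  next
    case (Some h)
    then have "(?t, x) \<in> R"
      using R_compat(2)[OF t x] by (simp add: affine_brandt0_simps add_const_Theta)
    then show ?thesis using t R_sym R_trans by blast
  qed
  show ?thesis
  proof (rule subset_antisym)
    show "R \<subseteq> carrier (affine_brandt0 n) \<times> carrier (affine_brandt0 n)"
      using R_carrier by auto
    show "carrier (affine_brandt0 n) \<times> carrier (affine_brandt0 n) \<subseteq> R"
      using R_trans[OF all R_sym[OF all]] by auto
  qed
qed

lemma congruence_cases: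
  "R = Id_on (carrier (affine_brandt0 n)) \<or>
   R = carrier (affine_brandt0 n) \<times> carrier (affine_brandt0 n) \<or>
   R = (Some ` carrier (affine_brandt n) \<times> Some ` carrier (affine_brandt n)) \<union> {(None, None)}"
proof (cases "\<exists>f. (Some f, None) \<in> R")
  case True
  then show ?thesis using zero_related_full by auto
next
  case False
  then have None_iff: "a = None \<longleftrightarrow> b = None" if "(a, b) \<in> R" for a b
    using that R_sym[OF that] by (cases a; cases b) auto
  show ?thesis
  proof (cases "\<exists>f g. (Some f, Some g) \<in> R \<and> f \<noteq> g")
    case True
    then obtain f g where fg: "(Some f, Some g) \<in> R" "f \<noteq> g" by blast
    let ?A = "carrier (affine_brandt n)"
    have "R \<subseteq> (Some ` ?A \<times> Some ` ?A) \<union> {(None, None)}"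
    proof (rule subrelI)
      fix a b assume ab: "(a, b) \<in> R"
      show "(a, b) \<in> (Some ` ?A \<times> Some ` ?A) \<union> {(None, None)}"
        using R_carrier[OF ab] None_iff[OF ab] by (auto simp: affine_brandt0_simps(1))
    qed
    moreover have "(Some h, Some k) \<in> R" if "h \<in> ?A" "k \<in> ?A" for h k
      using R_trans[OF distinct_maps_collapse[OF fg that(1)]
          R_sym[OF distinct_maps_collapse[OF fg that(2)]]] .
    moreover have "(None, None) \<in> R"
      using R_refl by (simp add: affine_brandt0_simps(1))
    ultimately show ?thesis by blast
  next
    case False
    then have "a = b" if "(a, b) \<in> R" for a b
      using that None_iff[OF that] by (cases a; cases b) auto
    then have "R = Id_on (carrier (affine_brandt0 n))"
      using R_refl R_carrier by (fastforce simp: Id_on_def)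
    then show ?thesis by simp
  qed
qed

end

theorem theorem5p1:
  fixes n :: nat
  assumes "n \<ge> 1"
  shows "{R. congruence (affine_brandt0 n) R} =
      {Id_on (carrier (affine_brandt0 n)),
       carrier (affine_brandt0 n) \<times> carrier (affine_brandt0 n),
       (Some ` carrier (affine_brandt n) \<times> Some ` carrier (affine_brandt n)) \<union>
         {(\<zero>\<^bsub>affine_brandt0 n\<^esub>, \<zero>\<^bsub>affine_brandt0 n\<^esub>)}} \<and>
    {I. ideal (affine_brandt0 n) I} =
      {carrier (affine_brandt0 n), {\<zero>\<^bsub>affine_brandt0 n\<^esub>}}"
proof
  let ?N = "affine_brandt0 n"
  let ?C = "(Some ` carrier (affine_brandt n) \<times> Some ` carrier (affine_brandt n)) \<union>
    {(\<zero>\<^bsub>?N\<^esub>, \<zero>\<^bsub>?N\<^esub>)}"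
  interpret N: zero_symmetric_near_semiring ?N
    by (rule zero_symmetric_affine_brandt0)
  have collapse: "congruence ?N ?C"
    using congruence_adjoin_zero_collapse[OF near_semiring_affine_brandt[of n]]
    by (simp add: affine_brandt0_simps(2)) (simp add: affine_brandt0_def)
  have cases: "R \<in> {Id_on (carrier ?N), carrier ?N \<times> carrier ?N, ?C}" if "congruence ?N R" for R
  proof -
    interpret affine_brandt0_congruence n R
      using assms that by unfold_locales
    show ?thesis using congruence_cases by (simp add: affine_brandt0_simps(2))
  qed
  show "{R. congruence ?N R} = {Id_on (carrier ?N), carrier ?N \<times> carrier ?N, ?C}"
    using cases collapse congruence_Id_on[OF N.near_semiring_axioms]
      congruence_full[OF N.near_semiring_axioms] by blast
  show "{I. ideal ?N I} = {carrier ?N, {\<zero>\<^bsub>?N\<^esub>}}"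
  proof (intro equalityI subsetI)
    fix I assume "I \<in> {I. ideal ?N I}"
    then obtain R where R: "congruence ?N R" "I = R `` {\<zero>\<^bsub>?N\<^esub>}"
      using ideal_zero_class[OF zero_symmetric_affine_brandt0] by blast
    from cases[OF R(1)] R(2) show "I \<in> {carrier ?N, {\<zero>\<^bsub>?N\<^esub>}}"
      by (auto simp: affine_brandt0_simps(1,2))
  qed (auto intro: ideal_carrier ideal_zero zero_symmetric_affine_brandt0)
qed

end
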